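(* Let $M$ and $N$ be $n$-manifolds with bounded geometry. Every $L$-BLD-mapping $f\colon M\to N$ is a discrete $L$-LQ-mapping. Conversely, every discrete $L$-LQ-mapping $f\colon M\to N$ is an $L'$-BLD-mapping, where $L'\ge 1$ depends only on $L$ and the bounded geometry constants of $M$ and $N$ (if both $M,N$ have $C$-bounded geometry one may take $L'=C^4L$). Furthermore, if $M$ and $N$ have strongly bounded geometry, one may take $L'=L$.
   Context: A metric manifold $M$ is said to have ($C$-)bounded geometry if it is a complete length space and there exist constants $C\ge 1$ and $R>0$ such that for every $x\in M$ there is a $C$-bilipschitz map $B_M(x,R)\to B_{\mathbb{R}^n}(0,R)$; here $B_X(x,r)$ denotes the open ball of radius $r$ about $x$ in a metric space $X$. $M$ has strongly bounded geometry if for every $C\ge1$ such a radius $R>0$ can be found. A map $f\colon M\to N$ between metric spaces is an $L$-BLD-mapping ($L\ge1$) if it is continuous, open and discrete and for every path $\beta\colon[0,1]\to M$ one has $L^{-1}\ell(\beta)\le \ell(f\circ\beta)\le L\,\ell(\beta)$, where $\ell$ denotes length. A map $f\colon M\to N$ is an $L$-Lipschitz quotient ($L$-LQ) mapping if $B_N(f(x),L^{-1}r)\subset f(B_M(x,r))\subset B_N(f(x),Lr)$ for all $x\in M$ and $r>0$. *)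

theory Defs
  imports "HOL-Analysis.Analysis" "HOL-Library.Extended_Real"
begin

definition plength :: "(real \<Rightarrow> 'a::metric_space) \<Rightarrow> ereal" where
  "plength g = (SUP p \<in> {(k::nat, t::nat \<Rightarrow> real). t 0 = 0 \<and> t k = 1 \<and> (\<forall>i<k. t i \<le> t (Suc i))}.
      ereal (\<Sum>i<fst p. dist (g (snd p (Suc i))) (g (snd p i))))"

definition length_space :: "'a::metric_space itself \<Rightarrow> bool" where
  "length_space _ \<longleftrightarrow> (\<forall>x y::'a. ereal (dist x y) =
      (INF g \<in> {g. path g \<and> pathstart g = x \<and> pathfinish g = y}. plength g))"

definition bilipschitz_on :: "real \<Rightarrow> 'a::metric_space set \<Rightarrow> ('a \<Rightarrow> 'b::metric_space) \<Rightarrow> bool" where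
  "bilipschitz_on C S f \<longleftrightarrow> (\<forall>x\<in>S. \<forall>y\<in>S. dist x y / C \<le> dist (f x) (f y) \<and> dist (f x) (f y) \<le> C * dist x y)"

definition bg_charts :: "'a::metric_space itself \<Rightarrow> 'e::euclidean_space itself \<Rightarrow> real \<Rightarrow> real \<Rightarrow> bool" where
  "bg_charts _ _ C R \<longleftrightarrow> C \<ge> 1 \<and> R > 0 \<and>
     (\<forall>x::'a. \<exists>\<phi> :: 'a \<Rightarrow> 'e. bilipschitz_on C (ball x R) \<phi> \<and> \<phi> ` ball x R = ball 0 R)"

definition C_bounded_geometry :: "'a::metric_space itself \<Rightarrow> 'e::euclidean_space itself \<Rightarrow> real \<Rightarrow> bool" where
  "C_bounded_geometry A E C \<longleftrightarrow> complete (UNIV::'a set) \<and> length_space A \<and> (\<exists>R. bg_charts A E C R)"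

definition bounded_geometry :: "'a::metric_space itself \<Rightarrow> 'e::euclidean_space itself \<Rightarrow> bool" where
  "bounded_geometry A E \<longleftrightarrow> (\<exists>C\<ge>1. C_bounded_geometry A E C)"

definition strongly_bounded_geometry :: "'a::metric_space itself \<Rightarrow> 'e::euclidean_space itself \<Rightarrow> bool" where
  "strongly_bounded_geometry A E \<longleftrightarrow> complete (UNIV::'a set) \<and> length_space A \<and>
     (\<forall>C\<ge>1. \<exists>R. bg_charts A E C R)"

definition open_map :: "('a::topological_space \<Rightarrow> 'b::topological_space) \<Rightarrow> bool" where
  "open_map f \<longleftrightarrow> (\<forall>U. open U \<longrightarrow> open (f ` U))"

definition discrete_map :: "('a::topological_space \<Rightarrow> 'b::topological_space) \<Rightarrow> bool" where
  "discrete_map f \<longleftrightarrow> (\<forall>y. discrete (f -` {y}))"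

definition BLD :: "real \<Rightarrow> ('a::metric_space \<Rightarrow> 'b::metric_space) \<Rightarrow> bool" where
  "BLD L f \<longleftrightarrow> L \<ge> 1 \<and> continuous_on UNIV f \<and> open_map f \<and> discrete_map f \<and>
     (\<forall>\<beta>::real \<Rightarrow> 'a. path \<beta> \<longrightarrow>
        plength \<beta> / ereal L \<le> plength (f \<circ> \<beta>) \<and> plength (f \<circ> \<beta>) \<le> ereal L * plength \<beta>)"

definition LQ :: "real \<Rightarrow> ('a::metric_space \<Rightarrow> 'b::metric_space) \<Rightarrow> bool" where
  "LQ L f \<longleftrightarrow> L \<ge> 1 \<and> (\<forall>x r. r > 0 \<longrightarrow>
     ball (f x) (r / L) \<subseteq> f ` ball x r \<and> f ` ball x r \<subseteq> ball (f x) (L * r))"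

end

(* A discrete L-LQ-mapping f satisfies d(z, x) <= L d(f z, f x) for all z near any given x, since the fibre of f x
   is isolated at x.  Along a path this pointwise estimate integrates (by bisection) to
   length(beta) <= L length(f o beta), so f is L-BLD without any loss in the constant; as L <= C^4 L, both
   converse statements follow.

   For a BLD-mapping, the inclusion f(B(x, r)) in B(f x, L r) is immediate in a length space.  The other
   one needs lifts of paths.  As M is proper (Hopf-Rinow) and f is uniformly open on compact sets, short paths
   can be lifted to discrete chains of arbitrarily small mesh.  Discreteness makes these chains
   equicontinuous, and a cluster point in the compact product space (Tychonoff) is a lift.  The BLD-condition bounds the
   lengths of the lifts, so that they stay in a fixed ball and can be continued in finitely many steps. *)

theory Submission
  imports Defs
begin

section \<open>Lengths and inscribed polygons\<close>

text \<open>\<open>s\<close> is the length of a polygon inscribed in \<open>g\<close> over [a, b].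
  The inductive form turns refinement, rescaling and mapping of partitions into rule inductions
  instead of reindexed sums.\<close>

inductive polygon :: "(real \<Rightarrow> 'a::metric_space) \<Rightarrow> real \<Rightarrow> real \<Rightarrow> real \<Rightarrow> bool" for g where
  refl: "polygon g a a 0"
| step: "polygon g a b s \<Longrightarrow> b \<le> c \<Longrightarrow> polygon g a c (s + dist (g c) (g b))"

lemma polygon_le: "polygon g a b s \<Longrightarrow> a \<le> b"
  by (induction rule: polygon.induct) auto

lemma polygon_segment: "a \<le> b \<Longrightarrow> polygon g a b (dist (g b) (g a))"
  using polygon.step[OF polygon.refl, of a b g] by simp

lemma polygon_trans: "polygon g b c s' \<Longrightarrow> polygon g a b s \<Longrightarrow> polygon g a c (s + s')"
proof (induction rule: polygon.induct)
  case (step b c s' d)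
  then show ?case
    using polygon.step[of g a c "s + s'" d] by (simp add: add.assoc)
qed simp

lemma polygon_partition:
  assumes "polygon g a b s"
  shows "\<exists>k t. t 0 = a \<and> t k = b \<and> (\<forall>i<k. t i \<le> t (Suc i)) \<and> s = (\<Sum>i<k. dist (g (t (Suc i))) (g (t i)))"
  using assms
proof (induction rule: polygon.induct)
  case (refl a)
  show ?case by (rule exI[of _ 0]) auto
next
  case (step a b s c)
  then obtain k t where t: "t 0 = a" "t k = b" "\<forall>i<k. t i \<le> t (Suc i)"
      "s = (\<Sum>i<k. dist (g (t (Suc i))) (g (t i)))"
    by blast
  show ?case
    using t step.hyps by (intro exI[of _ "Suc k"] exI[of _ "t(Suc k := c)"]) auto
qed

lemma partition_polygon:
  fixes t :: "nat \<Rightarrow> real"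
  assumes "\<forall>i<k. t i \<le> t (Suc i)"
  shows "polygon g (t 0) (t k) (\<Sum>i<k. dist (g (t (Suc i))) (g (t i)))"
  using assms by (induction k) (auto intro: polygon.intros)

text \<open>Partitions of [0, 1] and derivations of \<open>polygon g 0 1 s\<close> yield the same
  sums. From here on lengths are handled through \<open>polygon_le_plength\<close> and
  \<open>plength_least\<close>.\<close>

lemma plength_eq_SUP_polygon: "plength g = (SUP s \<in> {s. polygon g 0 1 s}. ereal s)"
  unfolding plength_def
proof (rule SUP_eq)
  fix p assume "p \<in> {(k::nat, t::nat \<Rightarrow> real). t 0 = 0 \<and> t k = 1 \<and> (\<forall>i<k. t i \<le> t (Suc i))}"
  then have *: "snd p 0 = 0" "snd p (fst p) = 1" "\<forall>i<fst p. snd p i \<le> snd p (Suc i)"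
    by auto
  show "\<exists>s\<in>{s. polygon g 0 1 s}. ereal (\<Sum>i<fst p. dist (g (snd p (Suc i))) (g (snd p i))) \<le> ereal s"
    using partition_polygon[OF *(3), of g] * by auto
next
  fix s assume "s \<in> {s. polygon g 0 1 s}"
  then obtain k t where "t 0 = 0" "t k = 1" "\<forall>i<k. t i \<le> t (Suc i)"
      "s = (\<Sum>i<k. dist (g (t (Suc i))) (g (t i)))"
    using polygon_partition by blast
  then show "\<exists>p\<in>{(k::nat, t::nat \<Rightarrow> real). t 0 = 0 \<and> t k = 1 \<and> (\<forall>i<k. t i \<le> t (Suc i))}.
      ereal s \<le> ereal (\<Sum>i<fst p. dist (g (snd p (Suc i))) (g (snd p i)))"
    by (intro bexI[of _ "(k, t)"]) auto
qed

lemma polygon_le_plength: "polygon g 0 1 s \<Longrightarrow> ereal s \<le> plength g"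
  unfolding plength_eq_SUP_polygon by (rule SUP_upper) simp

lemma plength_least: "(\<And>s. polygon g 0 1 s \<Longrightarrow> ereal s \<le> X) \<Longrightarrow> plength g \<le> X"
  unfolding plength_eq_SUP_polygon by (rule SUP_least) simp

lemma dist_le_plength: "ereal (dist (g 0) (g 1)) \<le> plength g"
  using polygon_le_plength[OF polygon_segment, of g] by (simp add: dist_commute)

lemma dist_via_le_plength:
  assumes "0 \<le> u" "u \<le> 1"
  shows "ereal (dist (g 0) (g u) + dist (g u) (g 1)) \<le> plength g"
  using polygon_le_plength[OF polygon_trans[OF polygon_segment[OF assms(2)] polygon_segment[OF assms(1)]]]
  by (simp add: dist_commute)

text \<open>Since \<open>plength\<close> always refers to [0, 1], a path on [0, T] is measured after
  rescaling; this compares a rescaled initial piece with the whole.\<close>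

lemma plength_initial_segment:
  assumes "0 \<le> T" "T \<le> 1"
  shows "plength (\<lambda>u. g (T * u)) \<le> plength g"
proof (rule plength_least)
  fix s assume "polygon (\<lambda>u. g (T * u)) 0 1 s"
  then have "polygon g (T * 0) (T * 1) s"
  proof (induction rule: polygon.induct)
    case (refl a) show ?case by (rule polygon.refl)
  next
    case (step a b s c)
    then show ?case using polygon.step[of g "T * a" "T * b" s "T * c"] assms
      by (simp add: mult_left_mono)
  qed
  \<comment> \<open>A last edge from T to 1 completes the partition and can only increase the
    sum.\<close>
  then have "polygon g 0 1 (s + dist (g 1) (g T))"
    using polygon.step[of g 0 T s 1] assms by simp
  from polygon_le_plength[OF this] show "ereal s \<le> plength g"
    by (rule order_trans[rotated]) simp
qed

lemma plength_Lipschitz_image: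
  assumes "0 \<le> L" and Lip: "\<And>x y. dist (f x) (f y) \<le> L * dist x y"
  shows "plength (f \<circ> g) \<le> ereal L * plength g"
proof (rule plength_least)
  have ex: "\<exists>s'. polygon g a b s' \<and> s \<le> L * s'" if "polygon (f \<circ> g) a b s" for a b s
    using that
  proof (induction rule: polygon.induct)
    case (refl a) then show ?case by (intro exI[of _ 0]) (auto intro: polygon.refl)
  next
    case (step a b s c)
    then obtain s' where "polygon g a b s'" "s \<le> L * s'" by blast
    then show ?case using step.hyps Lip[of "g c" "g b"]
      by (intro exI[of _ "s' + dist (g c) (g b)"]) (auto intro: polygon.step simp: algebra_simps)
  qed
  fix s assume "polygon (f \<circ> g) 0 1 s"
  then obtain s' where s': "polygon g 0 1 s'" "s \<le> L * s'" using ex by blast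
  have "ereal s \<le> ereal L * ereal s'" using s' by simp
  also have "\<dots> \<le> ereal L * plength g"
    using polygon_le_plength[OF s'(1)] assms(1) by (intro ereal_mult_left_mono) auto
  finally show "ereal s \<le> ereal L * plength g" .
qed

lemma plength_nonneg: "0 \<le> plength g"
  using order_trans[OF _ dist_le_plength, of 0 g] by simp

text \<open>A partition of [0, 1] never leaves that interval, so values elsewhere do not matter. A
  lift satisfies its equation on such an interval only.\<close>

lemma plength_cong_le:
  assumes eq: "\<And>u. u \<in> {0..1} \<Longrightarrow> g u = h u"
  shows "plength g \<le> plength h"
proof (rule plength_least)
  have "0 \<le> a \<Longrightarrow> b \<le> 1 \<Longrightarrow> polygon h a b s" if "polygon g a b s" for a b s
    using that
  proof (induction rule: polygon.induct)
    case (refl a) show ?case by (rule polygon.refl)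
  next
    case (step a b s c)
    then have "polygon h a b s" "0 \<le> b" "b \<le> 1" using polygon_le[OF step.hyps(1)] by auto
    then show ?case using polygon.step[of h a b s c] eq[of b] eq[of c] step by simp
  qed
  then show "ereal s \<le> plength h" if "polygon g 0 1 s" for s
    using that polygon_le_plength by fastforce
qed

section \<open>Discrete Lipschitz quotients\<close>

lemma discrete_map_isolated:
  fixes f :: "'a::metric_space \<Rightarrow> 'b::metric_space"
  assumes "discrete_map f"
  obtains r where "r > 0" "\<And>z. dist z x < r \<Longrightarrow> f z = f x \<Longrightarrow> z = x"
proof -
  have "x isolated_in (f -` {f x})"
    using assms unfolding discrete_map_def discrete_def by blast
  then obtain T where T: "open T" "T \<inter> f -` {f x} = {x}" unfolding isolated_in_def by blast
  then obtain r where "r > 0" "ball x r \<subseteq> T" by (metis Int_iff insertI1 open_contains_ball)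
  then show thesis using T that[of r] by (auto simp: subset_iff dist_commute)
qed

lemma LQ_Lipschitz:
  assumes "LQ L f"
  shows "dist (f x) (f y) \<le> L * dist x y"
proof (rule field_le_epsilon)
  fix e :: real assume "e > 0"
  have "L \<ge> 1" using assms unfolding LQ_def by blast
  \<comment> \<open>The extra \<open>e / L\<close> makes the radius positive, puts \<open>y\<close>
    inside the open ball, and becomes the error \<open>e\<close> after multiplication by
    \<open>L\<close>.\<close>
  then have r: "dist x y + e / L > 0" using \<open>e > 0\<close> by (simp add: add_nonneg_pos)
  then have "f ` ball x (dist x y + e / L) \<subseteq> ball (f x) (L * (dist x y + e / L))"
    using assms unfolding LQ_def by blast
  moreover have "y \<in> ball x (dist x y + e / L)" using \<open>e > 0\<close> \<open>L \<ge> 1\<close> by simp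
  ultimately have "dist (f x) (f y) < L * (dist x y + e / L)" by (meson image_subset_iff mem_ball)
  then show "dist (f x) (f y) \<le> L * dist x y + e" using \<open>L \<ge> 1\<close> by (simp add: algebra_simps)
qed

lemma LQ_open_map:
  assumes "LQ L f"
  shows "open_map f"
  unfolding open_map_def open_contains_ball
proof (intro allI impI ballI)
  fix U y assume U: "\<forall>x\<in>U. \<exists>e>0. ball x e \<subseteq> U" and "y \<in> f ` U"
  then obtain x e where "y = f x" "e > 0" "ball x e \<subseteq> U" by blast
  moreover have "L \<ge> 1" "ball (f x) (e / L) \<subseteq> f ` ball x e"
    using assms \<open>e > 0\<close> unfolding LQ_def by auto
  ultimately have "e / L > 0" "ball y (e / L) \<subseteq> f ` U" by (simp, blast)
  then show "\<exists>e>0. ball y e \<subseteq> f ` U" by blast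
qed

text \<open>If \<open>d(f z, f x) < d(z, x) / L\<close> then the ball around \<open>z\<close> of radius \<open>d(z, x)\<close> would contain a
  second preimage of \<open>f x\<close> near \<open>x\<close>.\<close>
lemma discrete_LQ_locally_expanding:
  fixes f :: "'a::metric_space \<Rightarrow> 'b::metric_space"
  assumes "discrete_map f" "LQ L f"
  obtains r where "r > 0" "\<And>z. dist z x < r \<Longrightarrow> dist z x \<le> L * dist (f z) (f x)"
proof -
  obtain r where r: "r > 0" "\<And>z. dist z x < r \<Longrightarrow> f z = f x \<Longrightarrow> z = x"
    using discrete_map_isolated[OF assms(1)] by metis
  have L: "L \<ge> 1" using assms unfolding LQ_def by blast
  \<comment> \<open>Half the isolation radius suffices: a preimage \<open>w\<close> of
    \<open>f x\<close> closer to \<open>z\<close> than \<open>x\<close> is satisfies d(w, x) < 2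
    d(z, x) < r.\<close>
  have "dist z x \<le> L * dist (f z) (f x)" if z: "dist z x < r / 2" for z
  proof (rule ccontr)
    assume neg: "\<not> ?thesis"
    then have pos: "dist z x > 0" using L by (smt (verit) mult_nonneg_nonneg zero_le_dist)
    then have "ball (f z) (dist z x / L) \<subseteq> f ` ball z (dist z x)"
      using assms(2) unfolding LQ_def by blast
    moreover have "f x \<in> ball (f z) (dist z x / L)" using neg L by (simp add: field_simps)
    ultimately obtain w where w: "f w = f x" "dist z w < dist z x" by (metis imageE mem_ball subsetD)
    then have "dist w x < r" using z dist_triangle[of w x z] by (simp add: dist_commute)
    then have "w = x" using r w by blast
    then show False using w by simp
  qed
  then show thesis using that[of "r / 2"] r by simp
qed

section \<open>Lengths of paths under discrete Lipschitz quotients\<close>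

text \<open>The expanding estimate is available only for pairs containing the centre, with a radius
  depending on it. Bisection needs no more: a short interval around \<open>x\<close> is split at
  \<open>x\<close>, and the estimates of adjoining intervals add.\<close>

lemma discrete_LQ_polygon:
  fixes f :: "'a::metric_space \<Rightarrow> 'b::metric_space"
  assumes f: "discrete_map f" "LQ L f" and \<beta>: "path \<beta>" and ab: "0 \<le> a" "a \<le> b" "b \<le> 1"
  shows "\<exists>s. polygon (f \<circ> \<beta>) a b s \<and> dist (\<beta> a) (\<beta> b) \<le> L * s"
proof -
  have "0 \<le> a \<and> b \<le> 1 \<longrightarrow> (\<exists>s. polygon (f \<circ> \<beta>) a b s \<and> dist (\<beta> a) (\<beta> b) \<le> L * s)"
    using ab(2)
  proof (induction rule: Bolzano)
    case (trans a b c)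
    show ?case
    proof
      assume "0 \<le> a \<and> c \<le> 1"
      then obtain s s' where "polygon (f \<circ> \<beta>) a b s" "dist (\<beta> a) (\<beta> b) \<le> L * s"
          "polygon (f \<circ> \<beta>) b c s'" "dist (\<beta> b) (\<beta> c) \<le> L * s'"
        using trans by (meson order_trans)
      then show "\<exists>s. polygon (f \<circ> \<beta>) a c s \<and> dist (\<beta> a) (\<beta> c) \<le> L * s"
        using dist_triangle[of "\<beta> a" "\<beta> c" "\<beta> b"] polygon_trans
        by (intro exI[of _ "s + s'"]) (auto simp: algebra_simps)
    qed
  next
    case (local x)
    then have x: "x \<in> {0..1}" using ab by simp
    obtain r where r: "r > 0" "\<And>z. dist z (\<beta> x) < r \<Longrightarrow> dist z (\<beta> x) \<le> L * dist (f z) (f (\<beta> x))"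
      using discrete_LQ_locally_expanding[OF f] by metis
    obtain d where d: "d > 0" "\<And>t. t \<in> {0..1} \<Longrightarrow> dist t x < d \<Longrightarrow> dist (\<beta> t) (\<beta> x) < r"
      using \<beta> x r(1) unfolding path_def continuous_on_iff by metis
    have "\<exists>s. polygon (f \<circ> \<beta>) u v s \<and> dist (\<beta> u) (\<beta> v) \<le> L * s"
      if uv: "u \<le> x" "x \<le> v" "v - u < d" "0 \<le> u" "v \<le> 1" for u v
    proof -
      have "dist (\<beta> u) (\<beta> x) \<le> L * dist (f (\<beta> u)) (f (\<beta> x))"
           "dist (\<beta> v) (\<beta> x) \<le> L * dist (f (\<beta> v)) (f (\<beta> x))"
        using uv by (auto intro!: r d simp: dist_real_def)
      then have "dist (\<beta> u) (\<beta> v) \<le> L * (dist ((f \<circ> \<beta>) x) ((f \<circ> \<beta>) u) + dist ((f \<circ> \<beta>) v) ((f \<circ> \<beta>) x))"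
        using dist_triangle2[of "\<beta> u" "\<beta> v" "\<beta> x"] by (simp add: algebra_simps dist_commute)
      then show ?thesis using polygon_trans[OF polygon_segment polygon_segment] uv by blast
    qed
    then show ?case using d(1) by blast
  qed
  then show ?thesis using ab by blast
qed

text \<open>Each edge of a polygon inscribed in \<open>\<beta>\<close> is dominated by a polygon
  inscribed in \<open>f \<circ> \<beta>\<close> over the same subinterval; these are
  concatenated.\<close>

lemma discrete_LQ_plength:
  fixes f :: "'a::metric_space \<Rightarrow> 'b::metric_space"
  assumes f: "discrete_map f" "LQ L f" and \<beta>: "path \<beta>"
  shows "plength \<beta> \<le> ereal L * plength (f \<circ> \<beta>)"
proof (rule plength_least)
  have L: "L \<ge> 1" using f unfolding LQ_def by blast
  have ex: "0 \<le> a \<Longrightarrow> b \<le> 1 \<Longrightarrow> \<exists>s'. polygon (f \<circ> \<beta>) a b s' \<and> s \<le> L * s'" if "polygon \<beta> a b s" for a b s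
    using that
  proof (induction rule: polygon.induct)
    case (refl a) then show ?case by (intro exI[of _ 0]) (auto intro: polygon.refl)
  next
    case (step a b s c)
    then obtain s' where s': "polygon (f \<circ> \<beta>) a b s'" "s \<le> L * s'" by (meson order_trans)
    obtain s'' where "polygon (f \<circ> \<beta>) b c s''" "dist (\<beta> b) (\<beta> c) \<le> L * s''"
      using discrete_LQ_polygon[OF f \<beta>, of b c] step polygon_le by fastforce
    then have "polygon (f \<circ> \<beta>) a c (s' + s'')" "s + dist (\<beta> c) (\<beta> b) \<le> L * (s' + s'')"
      using s' polygon_trans by (auto simp: algebra_simps dist_commute)
    then show ?case by blast
  qed
  fix s assume "polygon \<beta> 0 1 s"
  then obtain s' where s': "polygon (f \<circ> \<beta>) 0 1 s'" "s \<le> L * s'" using ex by fastforce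
  have "ereal s \<le> ereal L * ereal s'" using s' by simp
  also have "\<dots> \<le> ereal L * plength (f \<circ> \<beta>)"
    using polygon_le_plength[OF s'(1)] L by (intro ereal_mult_left_mono) auto
  finally show "ereal s \<le> ereal L * plength (f \<circ> \<beta>)" .
qed

text \<open>The slack \<open>L \<le> L'\<close> lets one lemma serve both constants,
  \<open>C^4 * L\<close> and \<open>L\<close>.\<close>

lemma discrete_LQ_imp_BLD:
  fixes f :: "'a::metric_space \<Rightarrow> 'b::metric_space"
  assumes f: "discrete_map f" "LQ L f" and "L \<le> L'"
  shows "BLD L' f"
proof -
  have L: "L \<ge> 1" using f unfolding LQ_def by blast
  have mono: "ereal L * plength g \<le> ereal L' * plength g" for g :: "real \<Rightarrow> 'c::metric_space"
    using assms(3) plength_nonneg by (intro ereal_mult_right_mono) auto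
  have "L-lipschitz_on UNIV f"
    using LQ_Lipschitz[OF f(2)] L by (intro lipschitz_onI) auto
  then have "continuous_on UNIV f" by (rule lipschitz_on_continuous_on)
  moreover have "plength \<beta> / ereal L' \<le> plength (f \<circ> \<beta>)" if "path \<beta>" for \<beta>
    using order_trans[OF discrete_LQ_plength[OF f that] mono] L assms(3)
    by (subst ereal_divide_le_pos) auto
  moreover have "plength (f \<circ> \<beta>) \<le> ereal L' * plength \<beta>" for \<beta>
    using order_trans[OF plength_Lipschitz_image[OF _ LQ_Lipschitz[OF f(2)]] mono] L by auto
  ultimately show ?thesis
    unfolding BLD_def using LQ_open_map[OF f(2)] f(1) L assms(3) by auto
qed

section \<open>Lifting paths along discrete open maps\<close>

text \<open>The minimum over a finite subcover works everywhere, because a witness may be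
  decreased.\<close>

lemma compact_uniform_witness:
  fixes K :: "'a::metric_space set" and P :: "real \<Rightarrow> 'a \<Rightarrow> bool"
  assumes "compact K"
    and anti: "\<And>d d' z. P d z \<Longrightarrow> 0 < d' \<Longrightarrow> d' \<le> d \<Longrightarrow> P d' z"
    and local: "\<And>p. p \<in> K \<Longrightarrow> \<exists>d>0. \<exists>r>0. \<forall>z\<in>ball p r. P d z"
  shows "\<exists>d>0. \<forall>z\<in>K. P d z"
proof -
  obtain d r where dr: "\<And>p. p \<in> K \<Longrightarrow> d p > 0 \<and> r p > 0 \<and> (\<forall>z\<in>ball p (r p). P (d p) z)"
    using local by metis
  have "K \<subseteq> (\<Union>p\<in>K. ball p (r p))"
  proof
    fix p assume "p \<in> K" then show "p \<in> (\<Union>p\<in>K. ball p (r p))" using dr[of p] by (intro UN_I[of p]) auto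
  qed
  from compactE_image[OF assms(1) open_ball this]
  obtain F where F: "F \<subseteq> K" "finite F" "K \<subseteq> (\<Union>p\<in>F. ball p (r p))" .
  \<comment> \<open>The inserted 1 keeps the minimum defined when the subcover is empty.\<close>
  define e where "e = Min (insert 1 (d ` F))"
  have "e > 0" using F dr by (auto simp: e_def)
  moreover have "P e z" if "z \<in> K" for z
  proof -
    obtain p where "p \<in> F" "z \<in> ball p (r p)" using F(3) \<open>z \<in> K\<close> by blast
    moreover have "e \<le> d p" using F \<open>p \<in> F\<close> by (auto simp: e_def)
    ultimately show ?thesis using anti dr F \<open>e > 0\<close> by blast
  qed
  ultimately show ?thesis by blast
qed

text \<open>A discrete stand-in for a path over a short piece of curve. One parameter bounds both
  the steps and the drift of the images, so that a single application of
  \<open>compact_uniform_witness\<close> controls both.\<close>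

definition fine_chain :: "('a::metric_space \<Rightarrow> 'b::metric_space) \<Rightarrow> 'a set \<Rightarrow> real \<Rightarrow> (nat \<Rightarrow> 'a) \<Rightarrow> nat \<Rightarrow> bool" where
  "fine_chain f K d c n \<longleftrightarrow> (\<forall>i\<le>n. c i \<in> K) \<and> (\<forall>i<n. dist (c i) (c (Suc i)) < d) \<and>
    (\<forall>i\<le>n. dist (f (c i)) (f (c 0)) < d)"

lemma fine_chain_mono: "fine_chain f K d c n \<Longrightarrow> d \<le> d' \<Longrightarrow> fine_chain f K d' c n"
  unfolding fine_chain_def by (meson less_le_trans)

text \<open>A fine chain whose image stays near \<open>f p\<close> cannot cross a small annulus around \<open>p\<close>, because the
  annulus is compact and avoids the fibre of \<open>f p\<close>.\<close>
lemma chain_small_diameter: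
  fixes f :: "'a::metric_space \<Rightarrow> 'b::metric_space"
  assumes K: "compact K" and f: "continuous_on UNIV f" "discrete_map f" and "e > 0"
  shows "\<exists>d>0. \<forall>c n. fine_chain f K d c n \<longrightarrow> dist (c 0) (c n) < e"
proof -
  define P where "P d z \<longleftrightarrow> (\<forall>c n. c 0 = z \<and> fine_chain f K d c n \<longrightarrow> dist (c 0) (c n) < e)" for d z
  have "\<exists>d>0. \<exists>r>0. \<forall>z\<in>ball p r. P d z" if "p \<in> K" for p
  proof -
    obtain r0 where r0: "r0 > 0" "\<And>z. dist z p < r0 \<Longrightarrow> f z = f p \<Longrightarrow> z = p"
      using discrete_map_isolated[OF f(2)] by metis
    \<comment> \<open>\<open>2 * q < r0\<close> keeps the annulus off the fibre of
      \<open>f p\<close>; \<open>2 * q < e\<close> turns confinement to \<open>ball p q\<close> into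
      the diameter bound.\<close>
    define q where "q = min r0 e / 3"
    have q: "q > 0" "2 * q < r0" "2 * q < e" using r0(1) \<open>e > 0\<close> by (auto simp: q_def min_def)
    define S where "S = K \<inter> (cball p (2 * q) - ball p q)"
    have "compact S" unfolding S_def by (intro compact_Int_closed K closed_Diff) auto
    moreover have "f p \<notin> f ` S"
    proof
      assume "f p \<in> f ` S"
      then obtain z where z: "z \<in> S" "f z = f p" by auto
      then have "z = p" using r0(2)[of z] q by (simp add: S_def dist_commute)
      then show False using z q by (simp add: S_def)
    qed
    moreover have "closed (f ` S)"
      using \<open>compact S\<close> f(1) by (intro compact_imp_closed compact_continuous_image) (auto intro: continuous_on_subset)
    ultimately obtain m where m: "m > 0" "ball (f p) m \<subseteq> - f ` S"
      by (metis ComplI openE open_Compl)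
    obtain r1 where r1: "r1 > 0" "\<And>z. dist z p < r1 \<Longrightarrow> dist (f z) (f p) < m / 2"
      using f(1) m(1) unfolding continuous_on_iff by (metis UNIV_I half_gt_zero)
    \<comment> \<open>Steps below \<open>q\<close> cannot jump over the annulus. Images stay within
      \<open>m\<close> of \<open>f p\<close>: one half from the drift, one from continuity at
      \<open>p\<close>.\<close>
    define d where "d = min (m / 2) q"
    have "P d z" if z: "z \<in> ball p (min r1 q)" for z
      unfolding P_def
    proof (intro allI impI, elim conjE)
      fix c n assume "c 0 = z" "fine_chain f K d c n"
      then have c: "c 0 = z" "\<forall>i\<le>n. c i \<in> K" "\<forall>i<n. dist (c i) (c (Suc i)) < d"
        "\<forall>i\<le>n. dist (f (c i)) (f (c 0)) < d"
        by (auto simp: fine_chain_def)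
      \<comment> \<open>The next point lies in \<open>cball p (2 * q)\<close>, and its image is too
        close to \<open>f p\<close> for it to lie in \<open>S\<close>; hence it is in
        \<open>ball p q\<close> again.\<close>
      have near: "i \<le> n \<Longrightarrow> dist p (c i) < q" for i
      proof (induction i)
        case 0 then show ?case using c z by simp
      next
        case (Suc i)
        then have "dist p (c i) < q" "dist (c i) (c (Suc i)) < q" using c by (auto simp: d_def)
        then have "dist p (c (Suc i)) \<le> 2 * q" using dist_triangle[of p "c (Suc i)" "c i"] by simp
        moreover have "dist (f p) (f (c (Suc i))) < m"
        proof -
          have "dist (f (c (Suc i))) (f z) < m / 2" using c(1,4) Suc.prems by (auto simp: d_def)
          moreover have "dist (f z) (f p) < m / 2" using r1(2)[of z] z by (simp add: dist_commute)
          ultimately show ?thesis using dist_triangle[of "f p" "f (c (Suc i))" "f z"] by (simp add: dist_commute)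
        qed
        ultimately show ?case using m(2) c Suc.prems by (fastforce simp: S_def)
      qed
      have "dist (c 0) (c n) < 2 * q"
        using near[of 0] near[of n] dist_triangle[of "c 0" "c n" p] by (simp add: dist_commute)
      then show "dist (c 0) (c n) < e" using q by simp
    qed
    then show ?thesis using m(1) r1(1) q(1)
      by (intro exI[of _ d] conjI exI[of _ "min r1 q"]) (auto simp: d_def)
  qed
  moreover have "P d' z" if "P d z" "d' \<le> d" for d d' z
    using that fine_chain_mono unfolding P_def by blast
  ultimately have "\<exists>d>0. \<forall>z\<in>K. P d z"
    by (intro compact_uniform_witness[OF K, of P]) blast+
  then show ?thesis unfolding P_def by (metis fine_chain_def le0)
qed

text \<open>A ball contained in the image of \<open>ball p (e / 2)\<close> serves, with half its
  radius, all \<open>z\<close> near \<open>p\<close>: \<open>ball p (e / 2)\<close> lies in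
  \<open>ball z e\<close> and \<open>f z\<close> moves little.\<close>

lemma open_map_uniform:
  fixes f :: "'a::metric_space \<Rightarrow> 'b::metric_space"
  assumes K: "compact K" and f: "continuous_on UNIV f" "open_map f" and "e > 0"
  obtains d where "d > 0" "\<And>z. z \<in> K \<Longrightarrow> ball (f z) d \<subseteq> f ` ball z e"
proof -
  have local: "\<exists>d>0. \<exists>r>0. \<forall>z\<in>ball p r. ball (f z) d \<subseteq> f ` ball z e" for p
  proof -
    have "open (f ` ball p (e / 2))" using f(2) unfolding open_map_def by blast
    then obtain q where q: "q > 0" "ball (f p) q \<subseteq> f ` ball p (e / 2)"
      using \<open>e > 0\<close> by (metis centre_in_ball half_gt_zero image_eqI open_contains_ball)
    obtain r where r: "r > 0" "\<And>z. dist z p < r \<Longrightarrow> dist (f z) (f p) < q / 2"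
      using f(1) q(1) unfolding continuous_on_iff by (metis UNIV_I half_gt_zero)
    have "ball (f z) (q / 2) \<subseteq> f ` ball z e" if "z \<in> ball p (min r (e / 2))" for z
    proof -
      have z: "dist z p < r" "dist z p < e / 2" using that by (auto simp: dist_commute)
      have "ball (f z) (q / 2) \<subseteq> ball (f p) q"
      proof
        fix y assume "y \<in> ball (f z) (q / 2)"
        then show "y \<in> ball (f p) q"
          using r(2)[OF z(1)] dist_triangle[of "f p" y "f z"] by (simp add: dist_commute)
      qed
      also have "\<dots> \<subseteq> f ` ball p (e / 2)" by (rule q)
      also have "\<dots> \<subseteq> f ` ball z e"
      proof (rule image_mono, rule)
        fix w assume "w \<in> ball p (e / 2)"
        then show "w \<in> ball z e" using z(2) dist_triangle[of z w p] by simp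
      qed
      finally show ?thesis .
    qed
    then show "\<exists>d>0. \<exists>r>0. \<forall>z\<in>ball p r. ball (f z) d \<subseteq> f ` ball z e"
      using q(1) r(1) \<open>e > 0\<close> by (intro exI[of _ "q / 2"] conjI exI[of _ "min r (e / 2)"]) auto
  qed
  have "\<exists>d>0. \<forall>z\<in>K. ball (f z) d \<subseteq> f ` ball z e"
    by (rule compact_uniform_witness[OF K _ local]) (use subset_ball in blast)
  then show thesis using that by blast
qed

section \<open>Discrete lifts and their limits\<close>

text \<open>Points over successive times are chosen greedily by uniform openness. The chain built so
  far is fine, so it ends within \<open>\<rho> / 2\<close> of \<open>x\<close>; the next point
  therefore stays in \<open>K\<close> and the construction continues up to time
  \<open>\<epsilon>\<close>.\<close>

lemma chain_lift:
  fixes f :: "'a::metric_space \<Rightarrow> 'b::metric_space" and \<gamma> :: "real \<Rightarrow> 'b"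
  assumes K: "compact K" and f: "continuous_on UNIV f" "open_map f"
    and \<gamma>: "uniformly_continuous_on UNIV \<gamma>"
    and xK: "cball x \<rho> \<subseteq> K" and fx: "f x = \<gamma> \<tau>" and "\<rho> > 0" "d > 0"
    and small: "\<And>c n. fine_chain f K d c n \<Longrightarrow> dist (c 0) (c n) < \<rho> / 2"
    and \<epsilon>: "\<And>s. 0 \<le> s \<Longrightarrow> s \<le> \<epsilon> \<Longrightarrow> dist (\<gamma> (\<tau> + s)) (\<gamma> \<tau>) < d" and "\<epsilon> > 0" and "\<eta> > 0"
  shows "\<exists>h c. 0 < h \<and> h < \<eta> \<and> c 0 = x \<and> (\<forall>i. real i * h \<le> \<epsilon> \<longrightarrow> c i \<in> K \<and> f (c i) = \<gamma> (\<tau> + real i * h))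
    \<and> (\<forall>i. real (Suc i) * h \<le> \<epsilon> \<longrightarrow> dist (c i) (c (Suc i)) < \<eta>)"
proof -
  \<comment> \<open>The three bounds give the required mesh, make the chain fine for
    \<open>d\<close>, and keep the next point in \<open>cball x \<rho>\<close>.\<close>
  define \<theta> where "\<theta> = min \<eta> (min d (\<rho> / 2))"
  have \<theta>: "\<theta> > 0" using assms by (simp add: \<theta>_def)
  obtain \<kappa> where \<kappa>: "\<kappa> > 0" "\<And>z. z \<in> K \<Longrightarrow> ball (f z) \<kappa> \<subseteq> f ` ball z \<theta>"
    using open_map_uniform[OF K f \<theta>] by blast
  obtain \<omega> where \<omega>: "\<omega> > 0" "\<And>u v. dist u v < \<omega> \<Longrightarrow> dist (\<gamma> u) (\<gamma> v) < \<kappa>"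
    using \<gamma> \<kappa>(1) unfolding uniformly_continuous_on_def by (metis UNIV_I dist_commute)
  define h where "h = min \<omega> \<eta> / 2"
  have h: "h > 0" "h < \<omega>" "h < \<eta>" using \<omega>(1) \<open>\<eta> > 0\<close> by (auto simp: h_def min_def)
  \<comment> \<open>The recursion is total; \<open>inv\<close> shows that the choice succeeds as
    long as the time does not exceed \<open>\<epsilon>\<close>. Later points are arbitrary.\<close>
  define c where "c = rec_nat x (\<lambda>i z. SOME w. dist z w < \<theta> \<and> f w = \<gamma> (\<tau> + real (Suc i) * h))"
  have c0: "c 0 = x" by (simp add: c_def)
  have cSuc: "c (Suc i) = (SOME w. dist (c i) w < \<theta> \<and> f w = \<gamma> (\<tau> + real (Suc i) * h))" for i
    by (simp add: c_def)
  have inv: "real n * h \<le> \<epsilon> \<Longrightarrow> (\<forall>i\<le>n. c i \<in> K \<and> f (c i) = \<gamma> (\<tau> + real i * h)) \<and>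
      (\<forall>i<n. dist (c i) (c (Suc i)) < \<theta>)" for n
  proof (induction n)
    case 0
    have "x \<in> K" using xK \<open>\<rho> > 0\<close> by auto
    then show ?case using c0 fx by simp
  next
    case (Suc n)
    have "real n * h \<le> \<epsilon>" using Suc.prems h(1) by (simp add: algebra_simps)
    then have IH: "\<And>i. i \<le> n \<Longrightarrow> c i \<in> K \<and> f (c i) = \<gamma> (\<tau> + real i * h)"
       "\<And>i. i < n \<Longrightarrow> dist (c i) (c (Suc i)) < \<theta>" using Suc.IH by auto
    have "dist (f (c i)) (f (c 0)) < d" if "i \<le> n" for i
    proof -
      have "real i * h \<le> real n * h" using that h by (intro mult_right_mono) auto
      then have "real i * h \<le> \<epsilon>" "0 \<le> real i * h" using \<open>real n * h \<le> \<epsilon>\<close> h(1) by (linarith, simp)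
      then show ?thesis using IH(1)[OF that] \<epsilon>[of "real i * h"] c0 fx by simp
    qed
    then have near: "dist x (c n) < \<rho> / 2"
      using small[of c n] IH c0 by (auto simp: \<theta>_def fine_chain_def)
    have "\<gamma> (\<tau> + real (Suc n) * h) \<in> ball (f (c n)) \<kappa>"
      using IH(1)[of n] \<omega>(2)[of "\<tau> + real n * h" "\<tau> + real (Suc n) * h"] h
      by (simp add: dist_real_def algebra_simps)
    then have "\<gamma> (\<tau> + real (Suc n) * h) \<in> f ` ball (c n) \<theta>" using \<kappa>(2) IH(1) by blast
    then have "\<exists>w. dist (c n) w < \<theta> \<and> f w = \<gamma> (\<tau> + real (Suc n) * h)" by auto
    then have new: "dist (c n) (c (Suc n)) < \<theta>" "f (c (Suc n)) = \<gamma> (\<tau> + real (Suc n) * h)"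
      unfolding cSuc using someI_ex by (metis (mono_tags, lifting))+
    have "dist x (c (Suc n)) \<le> \<rho>"
      using near new(1) dist_triangle[of x "c (Suc n)" "c n"] by (simp add: \<theta>_def)
    then have "c (Suc n) \<in> K" using xK by auto
    then show ?case using new IH by (auto simp: le_Suc_eq less_Suc_eq)
  qed
  show ?thesis
  proof (intro exI[of _ h] exI[of _ c] conjI allI impI)
    fix i assume "real (Suc i) * h \<le> \<epsilon>"
    then show "dist (c i) (c (Suc i)) < \<eta>" using inv[of "Suc i"] by (auto simp: \<theta>_def)
  qed (use h c0 inv in auto)
qed

text \<open>Tychonoff's theorem: the topology on a function type is that of pointwise
  convergence.\<close>

lemma compact_functions_into: "compact (K :: 'a::topological_space set) \<Longrightarrow> compact {g :: 'i \<Rightarrow> 'a. \<forall>s. g s \<in> K}"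
proof -
  assume "compact K"
  then have "compactin (product_topology (\<lambda>_::'i. euclidean) UNIV) (PiE UNIV (\<lambda>_. K))"
    unfolding compactin_PiE by simp
  then show ?thesis
    by (simp add: euclidean_product_topology PiE_UNIV_domain Pi_def)
qed

text \<open>One \<open>\<epsilon>\<close> serves all starting points and all times, which makes
  continuation in finitely many steps possible. The lift is a pointwise cluster point of step
  functions made from chains of mesh tending to 0.\<close>

lemma local_lift:
  fixes f :: "'a::metric_space \<Rightarrow> 'b::metric_space" and \<gamma> :: "real \<Rightarrow> 'b"
  assumes K: "compact K" and f: "continuous_on UNIV f" "open_map f" "discrete_map f"
    and \<gamma>: "uniformly_continuous_on UNIV \<gamma>" and "\<rho> > 0"
  obtains \<epsilon> where "\<epsilon> > 0" "\<And>x \<tau>. cball x \<rho> \<subseteq> K \<Longrightarrow> f x = \<gamma> \<tau> \<Longrightarrow>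
    \<exists>\<alpha>. continuous_on {0..\<epsilon>} \<alpha> \<and> \<alpha> 0 = x \<and> (\<forall>s\<in>{0..\<epsilon>}. f (\<alpha> s) = \<gamma> (\<tau> + s))"
proof -
  have modulus: "\<exists>w>0. \<forall>u v. dist u v < w \<longrightarrow> dist (\<gamma> u) (\<gamma> v) < e" if "e > 0" for e
    using \<gamma> that unfolding uniformly_continuous_on_def by (metis UNIV_I dist_commute)
  obtain d where d: "d > 0" "\<And>c n. fine_chain f K d c n \<Longrightarrow> dist (c 0) (c n) < \<rho> / 2"
    using chain_small_diameter[OF K f(1,3) half_gt_zero[OF \<open>\<rho> > 0\<close>]] by blast
  obtain w where w: "w > 0" "\<And>u v. dist u v < w \<Longrightarrow> dist (\<gamma> u) (\<gamma> v) < d" using modulus[OF d(1)] by blast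
  define \<epsilon> where "\<epsilon> = w / 2"
  have \<epsilon>: "\<epsilon> > 0" "\<And>\<tau> s. 0 \<le> s \<Longrightarrow> s \<le> \<epsilon> \<Longrightarrow> dist (\<gamma> (\<tau> + s)) (\<gamma> \<tau>) < d"
    using w by (auto simp: \<epsilon>_def dist_real_def)
  have "\<exists>\<alpha>. continuous_on {0..\<epsilon>} \<alpha> \<and> \<alpha> 0 = x \<and> (\<forall>s\<in>{0..\<epsilon>}. f (\<alpha> s) = \<gamma> (\<tau> + s))"
    if x: "cball x \<rho> \<subseteq> K" and fx: "f x = \<gamma> \<tau>" for x \<tau>
  proof -
    have "\<forall>m::nat. \<exists>h c. 0 < h \<and> h < inverse (Suc m) \<and> c 0 = x \<and>
        (\<forall>i. real i * h \<le> \<epsilon> \<longrightarrow> c i \<in> K \<and> f (c i) = \<gamma> (\<tau> + real i * h)) \<and>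
        (\<forall>i. real (Suc i) * h \<le> \<epsilon> \<longrightarrow> dist (c i) (c (Suc i)) < inverse (Suc m))" (is "\<forall>m. ?P m")
    proof
      fix m :: nat
      have "0 < inverse (real (Suc m))" by simp
      note chain_lift[where f = f and \<gamma> = \<gamma> and x = x and \<tau> = \<tau>, OF K f(1,2) \<gamma> x fx \<open>\<rho> > 0\<close> d \<epsilon>(2,1) this]
      then show "?P m" .
    qed
    then obtain h c where hc: "\<forall>m. 0 < h m \<and> h m < inverse (Suc m) \<and> c m 0 = x \<and>
        (\<forall>i. real i * h m \<le> \<epsilon> \<longrightarrow> c m i \<in> K \<and> f (c m i) = \<gamma> (\<tau> + real i * h m)) \<and>
        (\<forall>i. real (Suc i) * h m \<le> \<epsilon> \<longrightarrow> dist (c m i) (c m (Suc i)) < inverse (Suc m))"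
      unfolding choice_iff by blast
    then have h: "\<And>m. 0 < h m" "\<And>m. h m < inverse (Suc m)" and c0: "\<And>m. c m 0 = x"
      and cK: "\<And>m i. real i * h m \<le> \<epsilon> \<Longrightarrow> c m i \<in> K"
      and fc: "\<And>m i. real i * h m \<le> \<epsilon> \<Longrightarrow> f (c m i) = \<gamma> (\<tau> + real i * h m)"
      and cc: "\<And>m i. real (Suc i) * h m \<le> \<epsilon> \<Longrightarrow> dist (c m i) (c m (Suc i)) < inverse (Suc m)"
      by blast+
    have small: "\<forall>\<^sub>F m in sequentially. inverse (real (Suc m)) < e" if "e > 0" for e :: real
      using LIMSEQ_inverse_real_of_nat that by (rule order_tendstoD)
    \<comment> \<open>\<open>k m s\<close> is the index of the last node of the m-th chain at or
      before time \<open>s\<close>.\<close>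
    define k where "k m s = nat \<lfloor>s / h m\<rfloor>" for m s
    have k: "real (k m s) * h m \<le> s" "s < real (k m s) * h m + h m" if "0 \<le> s" for m s
    proof -
      have "real (k m s) = of_int \<lfloor>s / h m\<rfloor>" using that h(1)[of m] by (simp add: k_def)
      then have "real (k m s) \<le> s / h m" "s / h m < real (k m s) + 1" by linarith+
      then show "real (k m s) * h m \<le> s" "s < real (k m s) * h m + h m"
        using h(1)[of m] by (simp_all add: field_simps)
    qed
    \<comment> \<open>The default value \<open>x\<close> lies in \<open>K\<close>, so
      \<open>g m\<close> belongs to the compact space of all functions into
      \<open>K\<close>.\<close>
    define g where "g m s = (if s \<in> {0..\<epsilon>} then c m (k m s) else x)" for m s
    have "x \<in> K" using x \<open>\<rho> > 0\<close> by auto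
    have gK: "g m \<in> {g. \<forall>s. g s \<in> K}" for m
    proof -
      have "g m s \<in> K" for s
        using cK[of "k m s" m] k(1)[of s m] \<open>x \<in> K\<close> by (auto simp: g_def)
      then show ?thesis by blast
    qed
    \<comment> \<open>A product over uncountably many coordinates is not sequentially compact in
      general, so a cluster point replaces a convergent subsequence. The filter \<open>G\<close>
      below refines \<open>F\<close> and converges to \<open>\<alpha>\<close>.\<close>
    define F where "F = filtermap g sequentially"
    have "F \<noteq> bot" by (simp add: F_def filtermap_bot_iff)
    moreover have "\<forall>\<^sub>F u in F. u \<in> {g. \<forall>s. g s \<in> K}" using gK by (simp add: F_def eventually_filtermap)
    ultimately obtain \<alpha> where "inf (nhds \<alpha>) F \<noteq> bot"
      using compact_functions_into[OF K] unfolding compact_filter by blast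
    define G where "G = inf (nhds \<alpha>) F"
    have G: "G \<noteq> bot" using \<open>inf (nhds \<alpha>) F \<noteq> bot\<close> by (simp add: G_def)
    have evG: "\<forall>\<^sub>F u in G. P u" if "\<forall>\<^sub>F m in sequentially. P (g m)" for P
    proof -
      have "\<forall>\<^sub>F u in F. P u" using that by (simp add: F_def eventually_filtermap)
      then show ?thesis unfolding G_def by (rule filter_leD[rotated]) simp
    qed
    have lim: "((\<lambda>u. u s) \<longlongrightarrow> \<alpha> s) G" for s
    proof -
      have "((\<lambda>u. u s) \<longlongrightarrow> \<alpha> s) (nhds \<alpha>)"
      proof (rule topological_tendstoI)
        fix S :: "'a set" assume S: "open S" "\<alpha> s \<in> S"
        have "open ((\<lambda>u. u s) -` S)"
          using S(1) by (intro open_vimage continuous_on_product_coordinates)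
        then show "\<forall>\<^sub>F u in nhds \<alpha>. u s \<in> S" using S(2) by (auto simp: eventually_nhds)
      qed
      then show ?thesis unfolding G_def by (rule tendsto_mono[rotated]) simp
    qed
    have start: "\<alpha> 0 = x"
    proof -
      have "g m 0 = x" for m using c0 by (simp add: g_def k_def)
      then have "\<forall>\<^sub>F u in G. u 0 = x" by (intro evG) simp
      then have "((\<lambda>u. u 0) \<longlongrightarrow> x) G" by (rule tendsto_eventually)
      then show ?thesis using lim tendsto_unique[OF G] by blast
    qed
    have lift: "f (\<alpha> s) = \<gamma> (\<tau> + s)" if s: "s \<in> {0..\<epsilon>}" for s
    proof -
      \<comment> \<open>The node before \<open>s\<close> approaches \<open>s\<close>, so the images
        along \<open>G\<close> tend to \<open>\<gamma> (\<tau> + s)\<close>; by continuity of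
        \<open>f\<close> they also tend to \<open>f (\<alpha> s)\<close>.\<close>
      have "((\<lambda>u. f (u s)) \<longlongrightarrow> \<gamma> (\<tau> + s)) G"
      proof (rule tendstoI)
        fix e :: real assume "e > 0"
        then obtain w' where w': "w' > 0" "\<And>u v. dist u v < w' \<Longrightarrow> dist (\<gamma> u) (\<gamma> v) < e"
          using modulus by blast
        show "\<forall>\<^sub>F u in G. dist (f (u s)) (\<gamma> (\<tau> + s)) < e"
        proof (rule evG, rule eventually_mono[OF small[OF w'(1)]])
          fix m assume m: "inverse (real (Suc m)) < w'"
          have "f (g m s) = \<gamma> (\<tau> + real (k m s) * h m)"
            using fc[of "k m s" m] k(1)[of s m] s by (simp add: g_def)
          moreover have "dist (\<tau> + real (k m s) * h m) (\<tau> + s) < w'"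
            using k[of s m] s h(2)[of m] m by (simp add: dist_real_def)
          ultimately show "dist (f (g m s)) (\<gamma> (\<tau> + s)) < e" using w'(2) by simp
        qed
      qed
      moreover have "((\<lambda>u. f (u s)) \<longlongrightarrow> f (\<alpha> s)) G"
        using lim f(1) by (metis UNIV_I continuous_on_eq_continuous_at isCont_tendsto_compose open_UNIV)
      ultimately show ?thesis using tendsto_unique[OF G] by blast
    qed
    have equi: "\<exists>\<delta>>0. \<forall>s\<in>{0..\<epsilon>}. \<forall>s'\<in>{0..\<epsilon>}. dist s s' < \<delta> \<longrightarrow> dist (\<alpha> s) (\<alpha> s') \<le> e" if "e > 0" for e
    proof -
      obtain q where q: "q > 0" "\<And>c n. fine_chain f K q c n \<Longrightarrow> dist (c 0) (c n) < e"
        using chain_small_diameter[OF K f(1,3) \<open>e > 0\<close>] by blast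
      obtain w' where w': "w' > 0" "\<And>u v. dist u v < w' \<Longrightarrow> dist (\<gamma> u) (\<gamma> v) < q"
        using modulus[OF q(1)] by blast
      have ordered: "dist (\<alpha> s) (\<alpha> s') \<le> e"
        if s: "0 \<le> s" "s \<le> s'" "s' \<le> \<epsilon>" "s' - s < w' / 2" for s s'
      proof -
        have "\<forall>\<^sub>F m in sequentially. dist (g m s) (g m s') \<le> e"
        proof (rule eventually_mono)
          show "\<forall>\<^sub>F m in sequentially. inverse (real (Suc m)) < min q (w' / 2)"
            using q(1) w'(1) by (intro small) simp
          fix m assume m: "inverse (real (Suc m)) < min q (w' / 2)"
          \<comment> \<open>The nodes between \<open>s\<close> and \<open>s'\<close> form a fine
            chain for \<open>q\<close>: its steps are below \<open>q\<close>, and its duration is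
            below \<open>(s' - s) + h m < w'\<close>. Its endpoints are the values of
            \<open>g m\<close> at \<open>s\<close> and \<open>s'\<close>.\<close>
          define n where "n = k m s' - k m s"
          have "k m s \<le> k m s'" unfolding k_def
            using s h(1)[of m] by (intro nat_mono floor_mono divide_right_mono) auto
          then have n: "k m s + n = k m s'" by (simp add: n_def)
          have bound: "real (k m s + i) * h m \<le> real (k m s') * h m" if "i \<le> n" for i
            using that n h(1)[of m] by (intro mult_right_mono) auto
          have le: "real (k m s + i) * h m \<le> \<epsilon>" if "i \<le> n" for i
            using bound[OF that] k(1)[of s' m] s by simp
          have "fine_chain f K q (\<lambda>i. c m (k m s + i)) n"
            unfolding fine_chain_def
          proof (intro conjI allI impI)
            fix i assume "i \<le> n" then show "c m (k m s + i) \<in> K" using cK le by blast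
          next
            fix i assume "i < n"
            then have "dist (c m (k m s + i)) (c m (Suc (k m s + i))) < inverse (Suc m)"
              using le[of "Suc i"] by (intro cc) simp
            then show "dist (c m (k m s + i)) (c m (k m s + Suc i)) < q" using m by simp
          next
            fix i assume i: "i \<le> n"
            have "real (k m s + i) * h m - real (k m s) * h m \<ge> 0" using h(1)[of m] by (simp add: algebra_simps)
            moreover have "real (k m s + i) * h m - real (k m s) * h m < w'"
              using bound[OF i] k(1)[of s' m] k(2)[of s m] s h(2)[of m] m by simp
            ultimately have "dist (\<tau> + real (k m s + i) * h m) (\<tau> + real (k m s + 0) * h m) < w'"
              by (simp add: dist_real_def)
            then show "dist (f (c m (k m s + i))) (f (c m (k m s + 0))) < q"
              using w'(2) fc[OF le[OF i]] fc[OF le[of 0]] by simp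
          qed
          then show "dist (g m s) (g m s') \<le> e" using q(2) s n by (fastforce simp: g_def)
        qed
        then have "\<forall>\<^sub>F u in G. dist (u s) (u s') \<le> e" by (rule evG)
        then show ?thesis using tendsto_upperbound[OF tendsto_dist[OF lim lim] _ G] by blast
      qed
      have "dist (\<alpha> s) (\<alpha> s') \<le> e" if "s \<in> {0..\<epsilon>}" "s' \<in> {0..\<epsilon>}" "dist s s' < w' / 2" for s s'
        using that ordered[of s s'] ordered[of s' s] by (cases "s \<le> s'") (auto simp: dist_real_def dist_commute)
      then show ?thesis using w'(1) by (intro exI[of _ "w' / 2"]) auto
    qed
    have "continuous_on {0..\<epsilon>} \<alpha>"
      unfolding continuous_on_iff
    proof (intro ballI allI impI)
      fix s and e :: real assume s: "s \<in> {0..\<epsilon>}" "0 < e"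
      then obtain \<delta> where "\<delta> > 0" "\<forall>s\<in>{0..\<epsilon>}. \<forall>s'\<in>{0..\<epsilon>}. dist s s' < \<delta> \<longrightarrow> dist (\<alpha> s) (\<alpha> s') \<le> e / 2"
        using equi[of "e / 2"] by auto
      then show "\<exists>d>0. \<forall>s'\<in>{0..\<epsilon>}. dist s' s < d \<longrightarrow> dist (\<alpha> s') (\<alpha> s) < e"
        using s by (intro exI[of _ \<delta>]) fastforce
    qed
    then show ?thesis using start lift by blast
  qed
  then show thesis using that \<epsilon>(1) by blast
qed

text \<open>The hypothesis \<open>stay\<close> confines every partial lift in advance, so
  \<open>local_lift\<close> applies at each endpoint with the same
  \<open>\<epsilon>\<close>.\<close>

lemma path_lift:
  fixes f :: "'a::metric_space \<Rightarrow> 'b::metric_space"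
  assumes K: "compact K" and f: "continuous_on UNIV f" "open_map f" "discrete_map f"
    and \<gamma>: "path \<gamma>" and fx: "f x = \<gamma> 0" and "\<rho> > 0"
    and stay: "\<And>T \<alpha>. \<lbrakk>0 \<le> T; T \<le> 1; continuous_on {0..T} \<alpha>; \<alpha> 0 = x; \<And>t. t \<in> {0..T} \<Longrightarrow> f (\<alpha> t) = \<gamma> t\<rbrakk>
      \<Longrightarrow> cball (\<alpha> T) \<rho> \<subseteq> K"
  shows "\<exists>\<alpha>. path \<alpha> \<and> \<alpha> 0 = x \<and> (\<forall>t\<in>{0..1}. f (\<alpha> t) = \<gamma> t)"
proof -
  \<comment> \<open>Clamping extends \<open>\<gamma>\<close> to a uniformly continuous map on the
    line, so that the last local lift may run past time 1.\<close>
  define clamp where "clamp t = max 0 (min 1 t)" for t :: real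
  have clamp: "clamp t \<in> {0..1}" "dist (clamp s) (clamp t) \<le> dist s t" for s t
    by (auto simp: clamp_def dist_real_def)
  have clamp_id: "clamp t = t" if "0 \<le> t" "t \<le> 1" for t using that by (simp add: clamp_def)
  have "uniformly_continuous_on {0..1} \<gamma>"
    using \<gamma> unfolding path_def by (intro compact_uniformly_continuous) auto
  then have "uniformly_continuous_on UNIV (\<lambda>t. \<gamma> (clamp t))"
    unfolding uniformly_continuous_on_def using clamp by (meson UNIV_I order_le_less_trans)
  from local_lift[OF K f this \<open>\<rho> > 0\<close>] obtain \<epsilon> where \<epsilon>: "\<epsilon> > 0"
    "\<And>z \<tau>. cball z \<rho> \<subseteq> K \<Longrightarrow> f z = \<gamma> (clamp \<tau>) \<Longrightarrow>
      \<exists>\<alpha>. continuous_on {0..\<epsilon>} \<alpha> \<and> \<alpha> 0 = z \<and> (\<forall>s\<in>{0..\<epsilon>}. f (\<alpha> s) = \<gamma> (clamp (\<tau> + s)))"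
    by metis
  have lift: "\<exists>\<alpha>. continuous_on {0..min 1 (real n * \<epsilon>)} \<alpha> \<and> \<alpha> 0 = x \<and>
      (\<forall>t\<in>{0..min 1 (real n * \<epsilon>)}. f (\<alpha> t) = \<gamma> t)" for n
  proof (induction n)
    case 0
    show ?case using fx by (intro exI[of _ "\<lambda>_. x"]) auto
  next
    case (Suc n)
    define T where "T = min 1 (real n * \<epsilon>)"
    define T' where "T' = min 1 (real (Suc n) * \<epsilon>)"
    have T: "0 \<le> T" "T \<le> T'" "T' \<le> 1" "T' \<le> T + \<epsilon>"
      using \<epsilon>(1) by (auto simp: T_def T'_def min_def algebra_simps)
    obtain \<alpha> where \<alpha>: "continuous_on {0..T} \<alpha>" "\<alpha> 0 = x" "\<And>t. t \<in> {0..T} \<Longrightarrow> f (\<alpha> t) = \<gamma> t"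
      using Suc.IH unfolding T_def by blast
    have "cball (\<alpha> T) \<rho> \<subseteq> K" using stay[OF T(1) _ \<alpha>] T by simp
    moreover have "f (\<alpha> T) = \<gamma> (clamp T)" using \<alpha>(3) T clamp_id by simp
    ultimately obtain \<alpha>' where \<alpha>': "continuous_on {0..\<epsilon>} \<alpha>'" "\<alpha>' 0 = \<alpha> T"
        "\<And>s. s \<in> {0..\<epsilon>} \<Longrightarrow> f (\<alpha>' s) = \<gamma> (clamp (T + s))"
      using \<epsilon>(2) by metis
    define \<beta> where "\<beta> t = (if t \<le> T then \<alpha> t else \<alpha>' (t - T))" for t
    have "continuous_on {0..T'} \<beta>"
      unfolding \<beta>_def
    proof (rule continuous_on_cases_le)
      show "continuous_on {t \<in> {0..T'}. t \<le> T} \<alpha>" by (rule continuous_on_subset[OF \<alpha>(1)]) auto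
      show "continuous_on {t \<in> {0..T'}. T \<le> t} (\<lambda>t. \<alpha>' (t - T))"
        by (rule continuous_on_compose2[OF \<alpha>'(1)]) (use T in \<open>auto intro!: continuous_intros\<close>)
    qed (use \<alpha>' in \<open>auto intro!: continuous_intros\<close>)
    moreover have "f (\<beta> t) = \<gamma> t" if "t \<in> {0..T'}" for t
      using that \<alpha>(3)[of t] \<alpha>'(3)[of "t - T"] T clamp_id[of t] by (auto simp: \<beta>_def)
    moreover have "\<beta> 0 = x" using \<alpha>(2) T by (simp add: \<beta>_def)
    ultimately show ?case unfolding T'_def[symmetric] by blast
  qed
  obtain n where "1 < real n * \<epsilon>" using reals_Archimedean3[OF \<epsilon>(1)] by blast
  then show ?thesis using lift[of n] unfolding path_def by auto
qed

section \<open>Proper length spaces and BLD-mappings\<close>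

lemma length_space_path:
  fixes x y :: "'a::metric_space"
  assumes "length_space (M :: 'a itself)" "dist x y < l"
  obtains g where "path g" "g 0 = x" "g 1 = y" "plength g < ereal l"
proof -
  have "(INF g \<in> {g. path g \<and> pathstart g = x \<and> pathfinish g = y}. plength g) < ereal l"
    using assms unfolding length_space_def by (metis ereal_less_ereal_Ex less_ereal.simps(1))
  then show thesis using that unfolding INF_less_iff pathstart_def pathfinish_def by blast
qed

text \<open>Chart images are bounded, so a subsequence of them converges; the lower bilipschitz
  bound makes the original points Cauchy. Their limit comes from completeness, as the limit in the
  chart may lie on the boundary of \<open>ball 0 R\<close>.\<close>

lemma bg_charts_compact_cball:
  fixes x :: "'a::metric_space"
  assumes "complete (UNIV :: 'a set)" "bg_charts (M :: 'a itself) (E :: 'e::euclidean_space itself) C R"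
  shows "compact (cball x (R / 2))"
proof -
  obtain \<phi> :: "'a \<Rightarrow> 'e" where \<phi>: "bilipschitz_on C (ball x R) \<phi>" "\<phi> ` ball x R = ball 0 R"
    and C: "C \<ge> 1" and R: "R > 0"
    using assms(2) unfolding bg_charts_def by blast
  have sub: "cball x (R / 2) \<subseteq> ball x R" using R by auto
  show ?thesis
    unfolding compact_def
  proof (intro allI impI)
    fix s :: "nat \<Rightarrow> 'a" assume s: "\<forall>n. s n \<in> cball x (R / 2)"
    then have sR: "s n \<in> ball x R" for n using sub by blast
    then have "range (\<lambda>n. \<phi> (s n)) \<subseteq> ball 0 R" using \<phi>(2) by blast
    then have "bounded (range (\<lambda>n. \<phi> (s n)))" using bounded_ball bounded_subset by blast
    then obtain l r where r: "strict_mono (r :: nat \<Rightarrow> nat)" "((\<lambda>n. \<phi> (s n)) \<circ> r) \<longlonglongrightarrow> l"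
      using bounded_imp_convergent_subsequence by blast
    then have "Cauchy ((\<lambda>n. \<phi> (s n)) \<circ> r)" using LIMSEQ_imp_Cauchy by blast
    have "Cauchy (s \<circ> r)"
      unfolding Cauchy_def
    proof (intro allI impI)
      fix e :: real assume "e > 0"
      then obtain M where M: "\<And>m n. m \<ge> M \<Longrightarrow> n \<ge> M \<Longrightarrow> dist (\<phi> (s (r m))) (\<phi> (s (r n))) < e / C"
        using \<open>Cauchy ((\<lambda>n. \<phi> (s n)) \<circ> r)\<close> C unfolding Cauchy_def comp_def
        by (metis divide_pos_pos less_le_trans zero_less_one)
      have "dist (s (r m)) (s (r n)) < e" if "m \<ge> M" "n \<ge> M" for m n
      proof -
        have "dist (s (r m)) (s (r n)) / C \<le> dist (\<phi> (s (r m))) (\<phi> (s (r n)))"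
          using \<phi>(1) sR unfolding bilipschitz_on_def by blast
        also have "\<dots> < e / C" using M that by blast
        finally show ?thesis using C by (simp add: divide_less_cancel)
      qed
      then show "\<exists>M. \<forall>m\<ge>M. \<forall>n\<ge>M. dist ((s \<circ> r) m) ((s \<circ> r) n) < e" by auto
    qed
    then obtain z where z: "(s \<circ> r) \<longlonglongrightarrow> z" using assms(1) unfolding complete_def by blast
    then have "z \<in> cball x (R / 2)"
      using closed_sequentially[OF closed_cball _ z] s by (metis comp_apply)
    then show "\<exists>l\<in>cball x (R / 2). \<exists>r. strict_mono r \<and> (s \<circ> r) \<longlonglongrightarrow> l" using r(1) z by blast
  qed
qed

text \<open>The radius grows by \<open>\<rho> / 4\<close>: every point of the larger ball is within
  \<open>\<rho> / 2\<close> of a point of the smaller one, hence within \<open>\<rho>\<close> of a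
  finite net, and finitely many compact balls cover.\<close>

lemma length_space_proper:
  fixes x :: "'a::metric_space"
  assumes len: "length_space (M :: 'a itself)" and "\<rho> > 0" and cpt: "\<And>z :: 'a. compact (cball z \<rho>)"
  shows "compact (cball x r)"
proof -
  have "compact (cball x (real n * (\<rho> / 4)))" for n
  proof (induction n)
    case 0 show ?case by simp
  next
    case (Suc n)
    define s where "s = real n * (\<rho> / 4)"
    have "s \<ge> 0" using \<open>\<rho> > 0\<close> by (simp add: s_def)
    have cover: "cball x s \<subseteq> (\<Union>z\<in>cball x s. ball z (\<rho> / 4))"
      using \<open>\<rho> > 0\<close> by (intro subsetI UN_I) auto
    from compactE_image[OF Suc.IH[folded s_def] open_ball cover]
    obtain F where F: "F \<subseteq> cball x s" "finite F" "cball x s \<subseteq> (\<Union>z\<in>F. ball z (\<rho> / 4))" .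
    have "cball x (s + \<rho> / 4) \<subseteq> (\<Union>z\<in>F. cball z \<rho>)"
    proof
      fix w assume w: "w \<in> cball x (s + \<rho> / 4)"
      obtain v where v: "dist x v \<le> s" "dist v w < \<rho> / 2"
      proof (cases "dist x w \<le> s")
        case True
        then show thesis using that[of w] \<open>\<rho> > 0\<close> by simp
      next
        case False
        \<comment> \<open>The slack over \<open>s + \<rho> / 4\<close> is needed because shortest
          paths need not be available. The path crosses the sphere of radius \<open>s\<close>, and
          less than \<open>\<rho> / 2\<close> of its length remains.\<close>
        have "dist x w < s + \<rho> / 2" using w \<open>\<rho> > 0\<close> by simp
        then obtain g where g: "path g" "g 0 = x" "g 1 = w" "plength g < ereal (s + \<rho> / 2)"
          using length_space_path[OF len] by blast
        have "continuous_on {0..1} (\<lambda>t. dist x (g t))"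
          using g(1) unfolding path_def by (intro continuous_intros)
        then obtain u where u: "0 \<le> u" "u \<le> 1" "dist x (g u) = s"
          using IVT'[of "\<lambda>t. dist x (g t)" 0 s 1] g False \<open>s \<ge> 0\<close> by auto
        have "ereal (dist x (g u) + dist (g u) w) < ereal (s + \<rho> / 2)"
          using le_less_trans[OF dist_via_le_plength[OF u(1,2), of g] g(4)] g(2,3) by simp
        then show thesis using that[of "g u"] u by simp
      qed
      then obtain z where "z \<in> F" "dist z v < \<rho> / 4" using F(3) by auto
      then have "dist z w \<le> \<rho>" using v(2) dist_triangle[of z w v] \<open>\<rho> > 0\<close> by simp
      then show "w \<in> (\<Union>z\<in>F. cball z \<rho>)" using \<open>z \<in> F\<close> by auto
    qed
    moreover have "compact (\<Union>z\<in>F. cball z \<rho>)" using F(2) cpt by (intro compact_UN) auto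
    ultimately have "compact (cball x (s + \<rho> / 4))"
      by (metis closed_cball compact_Int_closed inf.absorb_iff2)
    moreover have "s + \<rho> / 4 = real (Suc n) * (\<rho> / 4)" by (simp add: s_def field_simps)
    ultimately show ?case by simp
  qed
  moreover obtain n where "r < real n * (\<rho> / 4)"
    using reals_Archimedean3[of "\<rho> / 4"] \<open>\<rho> > 0\<close> by auto
  ultimately have "compact (cball x (real n * (\<rho> / 4)) \<inter> cball x r)" by (intro compact_Int_closed) auto
  moreover have "cball x (real n * (\<rho> / 4)) \<inter> cball x r = cball x r"
    using \<open>r < _\<close> by auto
  ultimately show ?thesis by simp
qed

section \<open>From length distortion to ball inclusions\<close>

text \<open>Nearly shortest paths are pushed forward for the outer inclusion and lifted for the
  inner one.\<close>

lemma BLD_imp_LQ: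
  fixes f :: "'a::metric_space \<Rightarrow> 'b::metric_space"
  assumes M: "length_space (M :: 'a itself)" "\<And>(x::'a) r. compact (cball x r)"
    and N: "length_space (N :: 'b itself)" and f: "BLD L f"
  shows "LQ L f"
  unfolding LQ_def
proof (intro conjI allI impI)
  show L: "L \<ge> 1" using f unfolding BLD_def by blast
  have cod: "continuous_on UNIV f" "open_map f" "discrete_map f" using f unfolding BLD_def by auto
  have lower: "plength \<beta> \<le> ereal L * plength (f \<circ> \<beta>)" and upper: "plength (f \<circ> \<beta>) \<le> ereal L * plength \<beta>"
    if "path \<beta>" for \<beta>
    using f that L unfolding BLD_def by (auto simp: ereal_divide_le_pos)
  \<comment> \<open>Strictness survives in the extended reals because \<open>a\<close>, nonnegative
    and below a real, is finite.\<close>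
  have scale: "ereal L * a < ereal (L * b)" if "a < ereal b" "0 \<le> a" for a b
    using that L by (cases a) auto
  fix x :: 'a and r :: real assume "r > 0"
  show "f ` ball x r \<subseteq> ball (f x) (L * r)"
  proof
    fix y assume "y \<in> f ` ball x r"
    then obtain z where z: "y = f z" "dist x z < r" by auto
    then obtain \<beta> where \<beta>: "path \<beta>" "\<beta> 0 = x" "\<beta> 1 = z" "plength \<beta> < ereal r"
      using length_space_path[OF M(1)] by blast
    have "ereal (dist (f x) (f z)) \<le> plength (f \<circ> \<beta>)" using dist_le_plength[of "f \<circ> \<beta>"] \<beta> by simp
    also have "\<dots> \<le> ereal L * plength \<beta>" by (rule upper[OF \<beta>(1)])
    also have "\<dots> < ereal (L * r)" by (rule scale[OF \<beta>(4) plength_nonneg])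
    finally show "y \<in> ball (f x) (L * r)" using z by simp
  qed
  show "ball (f x) (r / L) \<subseteq> f ` ball x r"
  proof
    fix y assume "y \<in> ball (f x) (r / L)"
    then obtain \<gamma> where \<gamma>: "path \<gamma>" "\<gamma> 0 = f x" "\<gamma> 1 = y" "plength \<gamma> < ereal (r / L)"
      using length_space_path[OF N, of "f x" y "r / L"] by auto
    \<comment> \<open>Stated for partial lifts, it has two uses: it provides the confinement
      required by \<open>path_lift\<close>, and at \<open>T = 1\<close> it locates the preimage of
      \<open>y\<close>.\<close>
    have short: "dist x (\<alpha> T) < r"
      if T: "0 \<le> T" "T \<le> 1" and \<alpha>: "continuous_on {0..T} \<alpha>" "\<alpha> 0 = x" "\<And>t. t \<in> {0..T} \<Longrightarrow> f (\<alpha> t) = \<gamma> t"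
      for T \<alpha>
    proof -
      define \<beta> where "\<beta> u = \<alpha> (T * u)" for u
      have T_u: "T * u \<in> {0..T}" if "u \<in> {0..1}" for u
        using that T by (auto simp: mult_left_le)
      have "path \<beta>"
        unfolding path_def \<beta>_def
        by (rule continuous_on_compose2[OF \<alpha>(1)]) (use T_u in \<open>auto intro!: continuous_intros\<close>)
      have "ereal (dist x (\<alpha> T)) \<le> plength \<beta>" using dist_le_plength[of \<beta>] \<alpha>(2) by (simp add: \<beta>_def)
      also have "\<dots> \<le> ereal L * plength (f \<circ> \<beta>)" by (rule lower[OF \<open>path \<beta>\<close>])
      also have "\<dots> \<le> ereal L * plength (\<lambda>u. \<gamma> (T * u))"
        using L \<alpha>(3) T_u by (intro ereal_mult_left_mono plength_cong_le) (auto simp: \<beta>_def)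
      also have "\<dots> \<le> ereal L * plength \<gamma>"
        using L by (intro ereal_mult_left_mono plength_initial_segment T) auto
      also have "\<dots> < ereal (L * (r / L))" by (rule scale[OF \<gamma>(4) plength_nonneg])
      finally show ?thesis using L by simp
    qed
    \<comment> \<open>With margin 1 the compact set is \<open>cball x (r + 1)\<close>, which
      contains the unit ball about every point of \<open>ball x r\<close>.\<close>
    have "\<exists>\<alpha>. path \<alpha> \<and> \<alpha> 0 = x \<and> (\<forall>t\<in>{0..1}. f (\<alpha> t) = \<gamma> t)"
    proof (rule path_lift[OF M(2)[of x "r + 1"] cod \<gamma>(1) \<gamma>(2)[symmetric] zero_less_one])
      fix T \<alpha>
      assume "0 \<le> T" "T \<le> (1::real)" "continuous_on {0..T} \<alpha>" "\<alpha> 0 = x" "\<And>t. t \<in> {0..T} \<Longrightarrow> f (\<alpha> t) = \<gamma> t"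
      from short[OF this] show "cball (\<alpha> T) 1 \<subseteq> cball x (r + 1)"
        using dist_triangle[of x _ "\<alpha> T"] by (fastforce intro: order_trans)
    qed
    then obtain \<alpha> where "path \<alpha>" "\<alpha> 0 = x" "\<And>t. t \<in> {0..1} \<Longrightarrow> f (\<alpha> t) = \<gamma> t" by blast
    then have "dist x (\<alpha> 1) < r" "f (\<alpha> 1) = y" using short[of 1 \<alpha>] \<gamma>(3) by (auto simp: path_def)
    then show "y \<in> f ` ball x r" by auto
  qed
qed

theorem theorem1p1:
  fixes M :: "'a::metric_space itself" and N :: "'b::metric_space itself"
    and E :: "'e::euclidean_space itself"
  shows
   "(bounded_geometry M E \<and> bounded_geometry N E \<longrightarrow>
       (\<forall>L (f::'a \<Rightarrow> 'b). BLD L f \<longrightarrow> discrete_map f \<and> LQ L f))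
    \<and> (\<forall>C. C_bounded_geometry M E C \<and> C_bounded_geometry N E C \<longrightarrow>
       (\<forall>L (f::'a \<Rightarrow> 'b). discrete_map f \<and> LQ L f \<longrightarrow> BLD (C^4 * L) f))
    \<and> (strongly_bounded_geometry M E \<and> strongly_bounded_geometry N E \<longrightarrow>
       (\<forall>L (f::'a \<Rightarrow> 'b). discrete_map f \<and> LQ L f \<longrightarrow> BLD L f))"
proof (intro conjI impI allI; (elim conjE)?)
  fix L and f :: "'a \<Rightarrow> 'b" assume "BLD L f"
  then show "discrete_map f" unfolding BLD_def by blast
next
  fix L and f :: "'a \<Rightarrow> 'b"
  assume M: "bounded_geometry M E" and N: "bounded_geometry N E" and f: "BLD L f"
  obtain C R where complete: "complete (UNIV :: 'a set)" and len: "length_space M" and charts: "bg_charts M E C R"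
    using M unfolding bounded_geometry_def C_bounded_geometry_def by blast
  have "R / 2 > 0" using charts unfolding bg_charts_def by simp
  \<comment> \<open>Completeness and charts of a fixed radius give compact balls of radius
    \<open>R / 2\<close>; the length structure extends this to all radii.\<close>
  then have "compact (cball x r)" for x :: 'a and r
    using length_space_proper[OF len] bg_charts_compact_cball[OF complete charts] by blast
  moreover have "length_space N" using N unfolding bounded_geometry_def C_bounded_geometry_def by blast
  ultimately show "LQ L f" using BLD_imp_LQ len f by blast
next
  fix C L and f :: "'a \<Rightarrow> 'b"
  assume M: "C_bounded_geometry M E C" and f: "discrete_map f" "LQ L f"
  have "C \<ge> 1" using M unfolding C_bounded_geometry_def bg_charts_def by blast
  then have "1 * L \<le> C ^ 4 * L" using f(2) unfolding LQ_def by (intro mult_right_mono) (auto intro: one_le_power)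
  then show "BLD (C ^ 4 * L) f" using discrete_LQ_imp_BLD[OF f] by simp
next
  fix L and f :: "'a \<Rightarrow> 'b" assume "discrete_map f" "LQ L f"
  then show "BLD L f" by (rule discrete_LQ_imp_BLD) simp
qed

end
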